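(* Let $f:\mathbb{N}\times\mathbb{N}\to\mathbb{C}$ be an arithmetic function of two variables satisfying \[ \sum_{n_1,n_2=1}^\infty 2^{\omega(n_1)}2^{\omega(n_2)}\frac{|(f*\mu)(n_1,n_2)|}{n_1n_2}<\infty . \] Then for every $(n_1,n_2)\in\mathbb{N}\times\mathbb{N}$ the Ramanujan-Fourier series of $f$ converges and \[ f(n_1,n_2)=\sum_{q_1,q_2=1}^\infty a_{q_1,q_2}\,c_{q_1}(n_1)\,c_{q_2}(n_2), \qquad\text{where}\qquad a_{q_1,q_2}=\sum_{m_1,m_2=1}^\infty\frac{(f*\mu)(m_1q_1,m_2q_2)}{m_1q_1m_2q_2}. \]
   Context: For positive integers $q,n$, the Ramanujan sum is $c_q(n)=\sum_{1\le a\le q,\ \gcd(a,q)=1}\exp(2\pi i a n/q)$. $\omega(n)$ denotes the number of distinct prime divisors of $n$. For arithmetic functions $f,g:\mathbb{N}\times\mathbb{N}\to\mathbb{C}$, the Dirichlet convolution is $(f*g)(n_1,n_2)=\sum_{m_1\mid n_1,\ m_2\mid n_2} f(m_1,m_2)\,g(n_1/m_1,n_2/m_2)$. Here $\mu(n_1,n_2)=\mu(n_1)\mu(n_2)$, where $\mu$ on the right is the classical Möbius function. *)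

theory Defs
  imports "HOL-Analysis.Analysis" "HOL-Computational_Algebra.Squarefree"
begin

(* Arithmetic functions are functions on type nat of which only the values at positive
   arguments matter; all index sets below are subsets of {1..}. *)

definition ramanujan_sum :: "nat \<Rightarrow> nat \<Rightarrow> complex" where
  "ramanujan_sum q n =
     (\<Sum>a | 1 \<le> a \<and> a \<le> q \<and> coprime a q.
        exp (2 * of_real pi * \<i> * of_nat a * of_nat n / of_nat q))"

definition prime_omega :: "nat \<Rightarrow> nat" where
  "prime_omega n = card (prime_factors n)"

definition moebius :: "nat \<Rightarrow> int" where
  "moebius n = (if squarefree n then (- 1) ^ prime_omega n else 0)"

definition moebius2 :: "nat \<Rightarrow> nat \<Rightarrow> complex" where
  "moebius2 n1 n2 = of_int (moebius n1) * of_int (moebius n2)"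

definition dirichlet_conv2 ::
    "(nat \<Rightarrow> nat \<Rightarrow> complex) \<Rightarrow> (nat \<Rightarrow> nat \<Rightarrow> complex) \<Rightarrow> nat \<Rightarrow> nat \<Rightarrow> complex" where
  "dirichlet_conv2 f g n1 n2 =
     (\<Sum>m1 | m1 dvd n1. \<Sum>m2 | m2 dvd n2. f m1 m2 * g (n1 div m1) (n2 div m2))"

definition rf_coeff_term ::
    "(nat \<Rightarrow> nat \<Rightarrow> complex) \<Rightarrow> nat \<Rightarrow> nat \<Rightarrow> nat \<times> nat \<Rightarrow> complex" where
  "rf_coeff_term f q1 q2 = (\<lambda>(m1, m2).
     dirichlet_conv2 f moebius2 (m1 * q1) (m2 * q2)
       / (of_nat m1 * of_nat q1 * of_nat m2 * of_nat q2))"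

(* infsum is 0 for a family that is not summable, so summability of rf_coeff_term has to be
   stated separately wherever the coefficient is claimed to exist. *)
definition rf_coeff :: "(nat \<Rightarrow> nat \<Rightarrow> complex) \<Rightarrow> nat \<Rightarrow> nat \<Rightarrow> complex" where
  "rf_coeff f q1 q2 = infsum (rf_coeff_term f q1 q2) ({1..} \<times> {1..})"

end

theory Submission
  imports Defs
begin

text \<open>
  Put \<open>F = f * \<mu>\<close>. Writing \<open>N = m q\<close>, the double series over \<open>q\<close> and \<open>m\<close> becomes
  \<open>\<Sum>\<^sub>N F(N)/N \<Sum>\<^bsub>q | N\<^esub> c\<^sub>q(n)\<close> in each variable. The inner sum is \<open>N\<close> if \<open>N\<close> divides \<open>n\<close>
  and \<open>0\<close> otherwise, so the series collapses to the sum of \<open>F\<close> over the divisors of the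
  arguments, which is \<open>f\<close>. The rearrangement is legitimate because
  \<open>c\<^sub>q(n) = \<Sum>\<^bsub>d | q, d | n\<^esub> d \<mu>(q/d)\<close> gives
  \<open>\<Sum>\<^bsub>q | N\<^esub> |c\<^sub>q(n)| \<le> \<sigma>(n) 2\<^bsup>\<omega>(N)\<^esup>\<close>.
\<close>

section \<open>Squarefree divisors and divisor sums of the Moebius function\<close>

lemma prime_factors_prod_primes:
  fixes S :: "nat set"
  assumes "finite S" "\<And>p. p \<in> S \<Longrightarrow> prime p"
  shows "prime_factors (\<Prod>S) = S"
proof -
  have "0 \<notin> S"
    using assms(2) not_prime_0 by blast
  then have "prime_factors (prod id S) = \<Union>((prime_factors \<circ> id) ` S)"
    using assms(1) by (intro prime_factors_prod) auto
  then show ?thesis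
    using assms by (auto simp: prime_prime_factors)
qed

lemma squarefree_eq_prod_prime_factors:
  fixes n :: nat
  assumes "squarefree n"
  shows "\<Prod>(prime_factors n) = n"
proof -
  have "n > 0"
    using assms by (cases n) auto
  then have "n = (\<Prod>p\<in>prime_factors n. p ^ multiplicity p n)"
    by (simp add: prime_factorization_nat)
  also have "\<dots> = \<Prod>(prime_factors n)"
    using assms \<open>n > 0\<close> by (intro prod.cong) (auto simp: squarefree_factorial_semiring')
  finally show ?thesis ..
qed

text \<open>A squarefree number is the product of its primes, so \<open>\<Prod>\<close> inverts
  \<open>prime_factors\<close> here. Sums over squarefree divisors thereby become sums over subsets
  of a finite set.\<close>

lemma bij_betw_prime_factors_squarefree_divisors:
  fixes n :: nat
  assumes "n > 0"
  shows "bij_betw prime_factors {d. d dvd n \<and> squarefree d} (Pow (prime_factors n))"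
proof (rule bij_betwI[where g = "\<lambda>S. \<Prod>S"])
  show "prime_factors \<in> {d. d dvd n \<and> squarefree d} \<rightarrow> Pow (prime_factors n)"
    using assms by (auto simp: dvd_prime_factors)
  show "(\<lambda>S. \<Prod>S) \<in> Pow (prime_factors n) \<rightarrow> {d. d dvd n \<and> squarefree d}"
  proof (intro funcsetI CollectI conjI)
    fix S assume "S \<in> Pow (prime_factors n)"
    then have S: "S \<subseteq> prime_factors n" "finite S" "\<And>p. p \<in> S \<Longrightarrow> prime p"
      by (auto intro: finite_subset)
    have "\<Prod>S dvd \<Prod>(prime_factors n)"
      using S by (intro prod_dvd_prod_subset) auto
    \<comment> \<open>The radical of \<open>n\<close> divides \<open>n\<close>, since every prime
      factor has exponent at least 1.\<close>
    also have "\<dots> dvd (\<Prod>p\<in>prime_factors n. p ^ multiplicity p n)"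
      by (intro prod_dvd_prod dvd_power)
        (auto simp: prime_factors_multiplicity)
    also have "\<dots> = n"
      using assms by (simp add: prime_factorization_nat[symmetric])
    finally show "\<Prod>S dvd n" .
    show "squarefree (\<Prod>S)"
      using S by (intro squarefree_prod_coprime) (auto intro: primes_coprime squarefree_prime)
  qed
  show "\<Prod>(prime_factors d) = d" if "d \<in> {d. d dvd n \<and> squarefree d}" for d
    using that by (simp add: squarefree_eq_prod_prime_factors)
  show "prime_factors (\<Prod>S) = S" if "S \<in> Pow (prime_factors n)" for S
    using that by (intro prime_factors_prod_primes) (auto intro: finite_subset)
qed

lemma sum_moebius_divisors:
  assumes "n > 0"
  shows "(\<Sum>d | d dvd n. moebius d) = (if n = 1 then 1 else 0)"
proof -
  have "(\<Sum>d | d dvd n. moebius d) = (\<Sum>d | d dvd n \<and> squarefree d. (- 1) ^ card (prime_factors d))"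
    using assms by (intro sum.mono_neutral_cong_right) (auto simp: moebius_def prime_omega_def)
  also have "\<dots> = (\<Sum>S\<in>Pow (prime_factors n). (- 1) ^ card S)"
    by (rule sum.reindex_bij_betw[OF bij_betw_prime_factors_squarefree_divisors[OF assms]])
  \<comment> \<open>Expanding the product chooses -1 on a subset \<open>S\<close> and 1 on its
    complement. The product vanishes as soon as there is one prime factor.\<close>
  also have "\<dots> = (\<Prod>p\<in>prime_factors n. - 1 + 1)"
    by (subst prod_add) auto
  also have "\<dots> = (if n = 1 then 1 else 0)"
    using assms by (auto simp: card_gt_0_iff prime_factorization_empty_iff)
  finally show ?thesis .
qed

text \<open>Without signs the same bijection merely counts subsets of the prime factors. This is the
  source of the weights in the hypothesis of the theorem.\<close>

lemma sum_abs_moebius_divisors: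
  assumes "n > 0"
  shows "(\<Sum>d | d dvd n. \<bar>moebius d\<bar>) = 2 ^ prime_omega n"
proof -
  have "(\<Sum>d | d dvd n. \<bar>moebius d\<bar>) = (\<Sum>d | d dvd n \<and> squarefree d. 1)"
    using assms by (intro sum.mono_neutral_cong_right) (auto simp: moebius_def power_abs)
  also have "\<dots> = int (card (Pow (prime_factors n)))"
    using bij_betw_same_card[OF bij_betw_prime_factors_squarefree_divisors[OF assms]] by simp
  also have "\<dots> = 2 ^ prime_omega n"
    by (simp add: card_Pow prime_omega_def)
  finally show ?thesis .
qed

section \<open>Interchange of divisor sums and Moebius inversion\<close>

lemma sum_divisors_of_divisors:
  fixes g :: "nat \<Rightarrow> nat \<Rightarrow> 'a :: comm_monoid_add"
  assumes "n > 0"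
  shows "(\<Sum>d | d dvd n. \<Sum>e | e dvd d. g d e) = (\<Sum>e | e dvd n. \<Sum>k | k dvd n div e. g (e * k) e)"
proof -
  have pos: "d > 0" if "d dvd n" for d
    using that assms by (auto intro: Nat.gr0I)
  have "(\<Sum>d | d dvd n. \<Sum>e | e dvd d. g d e)
      = (\<Sum>(d, e)\<in>Sigma {d. d dvd n} (\<lambda>d. {e. e dvd d}). g d e)"
    using assms pos by (intro sum.Sigma) auto
  \<comment> \<open>The substitution is \<open>d = e * k\<close>: chains \<open>e dvd d\<close>,
    \<open>d dvd n\<close> correspond to a divisor \<open>e\<close> of \<open>n\<close> and a
    divisor \<open>k\<close> of the cofactor.\<close>
  also have "\<dots> = (\<Sum>(e, k)\<in>Sigma {e. e dvd n} (\<lambda>e. {k. k dvd n div e}). g (e * k) e)"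
    using assms pos
    by (intro sum.reindex_bij_witness[where i = "\<lambda>(e, k). (e * k, e)" and j = "\<lambda>(d, e). (e, d div e)"])
      (auto elim!: dvdE)
  also have "\<dots> = (\<Sum>e | e dvd n. \<Sum>k | k dvd n div e. g (e * k) e)"
    using assms pos by (intro sum.Sigma[symmetric] ballI finite_divisors_nat)
      (auto simp: div_greater_zero_iff dvd_imp_le)
  finally show ?thesis .
qed

lemma sum_divisors_reflect:
  fixes g :: "nat \<Rightarrow> 'a :: comm_monoid_add"
  assumes "n > 0"
  shows "(\<Sum>d | d dvd n. g (n div d)) = (\<Sum>d | d dvd n. g d)"
  using assms by (intro sum.reindex_bij_witness[of _ "(div) n" "(div) n"]) (auto elim: dvdE)

lemma sum_moebius_divisors_complex:
  assumes "n > 0"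
  shows "(\<Sum>d | d dvd n. of_int (moebius d) :: complex) = (if n = 1 then 1 else 0)"
  by (simp add: sum_moebius_divisors[OF assms] flip: of_int_sum)

text \<open>After the interchange, \<open>h e\<close> is multiplied by the sum of
  \<open>moebius\<close> over the divisors of \<open>n div e\<close>, which survives only for
  \<open>e = n\<close>.\<close>

lemma sum_moebius_convolution:
  fixes h :: "nat \<Rightarrow> complex"
  assumes "n > 0"
  shows "(\<Sum>d | d dvd n. \<Sum>m | m dvd d. of_int (moebius (d div m)) * h m) = h n"
proof -
  have "(\<Sum>d | d dvd n. \<Sum>m | m dvd d. of_int (moebius (d div m)) * h m)
      = (\<Sum>e | e dvd n. \<Sum>k | k dvd n div e. of_int (moebius (e * k div e)) * h e)"
    by (rule sum_divisors_of_divisors[OF assms])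
  also have "\<dots> = (\<Sum>e | e dvd n. if e = n then h e else 0)"
  proof (intro sum.cong refl)
    fix e assume "e \<in> {e. e dvd n}"
    then obtain k where k: "n = e * k"
      by auto
    with assms have "e > 0" "k > 0"
      by auto
    then show "(\<Sum>j | j dvd n div e. of_int (moebius (e * j div e)) * h e) = (if e = n then h e else 0)"
      using sum_moebius_divisors_complex[of k] by (simp add: k flip: sum_distrib_right)
  qed
  also have "\<dots> = h n"
    using assms by (simp add: sum.delta)
  finally show ?thesis .
qed

lemma moebius_inversion:
  fixes g h :: "nat \<Rightarrow> complex"
  assumes "n > 0" and h: "\<And>d. d dvd n \<Longrightarrow> h d = (\<Sum>e | e dvd d. g e)"
  shows "g n = (\<Sum>d | d dvd n. of_int (moebius (n div d)) * h d)"
proof -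
  have "(\<Sum>d | d dvd n. of_int (moebius (n div d)) * h d)
      = (\<Sum>d | d dvd n. \<Sum>e | e dvd d. of_int (moebius (n div d)) * g e)"
    by (simp add: h sum_distrib_left)
  also have "\<dots> = (\<Sum>e | e dvd n. \<Sum>k | k dvd n div e. of_int (moebius (n div (e * k))) * g e)"
    by (rule sum_divisors_of_divisors[OF assms(1)])
  also have "\<dots> = (\<Sum>e | e dvd n. if e = n then g e else 0)"
  proof (intro sum.cong refl)
    fix e assume "e \<in> {e. e dvd n}"
    then obtain k where k: "n = e * k"
      by auto
    with assms have "e > 0" "k > 0"
      by auto
    \<comment> \<open>Here \<open>moebius\<close> is evaluated at the complementary divisors
      \<open>k div j\<close>, so the sum is reflected before the divisor sum of
      \<open>moebius\<close> applies.\<close>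
    then show "(\<Sum>j | j dvd n div e. of_int (moebius (n div (e * j))) * g e) = (if e = n then g e else 0)"
      using sum_moebius_divisors_complex[of k]
        sum_divisors_reflect[of k "\<lambda>d. of_int (moebius d) :: complex"]
      by (simp add: k div_mult2_eq flip: sum_distrib_right)
  qed
  also have "\<dots> = g n"
    using assms by (simp add: sum.delta)
  finally show ?thesis ..
qed

section \<open>Ramanujan sums: divisor sums, divisor formula and bound\<close>

lemma sum_exp_equidistant:
  assumes "N > 0"
  shows "(\<Sum>k=1..N. exp (2 * of_real pi * \<i> * of_nat k * of_nat n / of_nat N))
       = (if N dvd n then of_nat N else (0 :: complex))"
proof -
  \<comment> \<open>The terms are powers of the \<open>N\<close>-th root of unity \<open>w\<close>.
    Their geometric sum vanishes because \<open>w ^ N = 1\<close>, unless \<open>w = 1\<close> and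
    every term is 1.\<close>
  define w :: complex where "w = exp (2 * of_real pi * \<i> * of_nat n / of_nat N)"
  have w1: "w = 1 \<longleftrightarrow> N dvd n"
    using complex_root_unity_eq_1[of N n] assms by (simp add: w_def algebra_simps)
  have wN: "w ^ N = 1"
    using complex_root_unity[of N n] assms by (simp add: w_def algebra_simps)
  have "(\<Sum>k=1..N. exp (2 * of_real pi * \<i> * of_nat k * of_nat n / of_nat N)) = (\<Sum>k=1..N. w ^ k)"
    by (intro sum.cong) (auto simp: w_def mult_ac simp flip: exp_of_nat_mult)
  also have "\<dots> = w * (\<Sum>k<N. w ^ k)"
    by (simp add: sum_distrib_left sum.atLeast1_atMost_eq)
  also have "\<dots> = (if N dvd n then of_nat N else 0)"
    using w1 wN by (auto simp: sum_gp_strict)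
  finally show ?thesis .
qed

text \<open>Each fraction \<open>k / N\<close> with \<open>1 \<le> k \<le> N\<close> has a unique
  reduced form \<open>a / q\<close> with \<open>q dvd N\<close>. The Ramanujan sums therefore
  partition the sum over all \<open>N\<close>-th roots of unity.\<close>

lemma sum_ramanujan_sum_divisors:
  assumes "N > 0"
  shows "(\<Sum>q | q dvd N. ramanujan_sum q n) = (if N dvd n then of_nat N else 0)"
proof -
  have pos: "q > 0" if "q dvd N" for q
    using that assms by (auto intro: Nat.gr0I)
  let ?A = "\<lambda>q. {a. 1 \<le> a \<and> a \<le> q \<and> coprime a q}"
  have "(\<Sum>q | q dvd N. ramanujan_sum q n)
      = (\<Sum>(q, a)\<in>Sigma {q. q dvd N} ?A. exp (2 * of_real pi * \<i> * of_nat a * of_nat n / of_nat q))"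
    unfolding ramanujan_sum_def using assms by (intro sum.Sigma) auto
  also have "\<dots> = (\<Sum>k=1..N. exp (2 * of_real pi * \<i> * of_nat k * of_nat n / of_nat N))"
  proof (intro sum.reindex_bij_witness[where j = "\<lambda>(q, a). a * (N div q)"
        and i = "\<lambda>k. (N div gcd k N, k div gcd k N)"])
    fix x assume "x \<in> Sigma {q. q dvd N} ?A"
    then obtain q a r where x: "x = (q, a)" and N: "N = q * r"
      and a: "1 \<le> a" "a \<le> q" "coprime a q"
      by (auto elim!: dvdE)
    from assms N have qr: "q > 0" "r > 0"
      by auto
    \<comment> \<open>Coprimality of \<open>a\<close> and \<open>q\<close> makes \<open>r\<close>
      the exact factor to cancel, so reducing \<open>a * r / (q * r)\<close> gives back
      \<open>a / q\<close>.\<close>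
    have g: "gcd (a * r) (q * r) = r"
      using a by (metis gcd_mult_distrib_nat coprime_imp_gcd_eq_1 mult.commute mult.right_neutral)
    show "(N div gcd (case x of (q, a) \<Rightarrow> a * (N div q)) N,
        (case x of (q, a) \<Rightarrow> a * (N div q)) div gcd (case x of (q, a) \<Rightarrow> a * (N div q)) N) = x"
      using qr g by (simp add: x N)
    show "(case x of (q, a) \<Rightarrow> a * (N div q)) \<in> {1..N}"
      using qr a by (simp add: x N)
    show "exp (2 * of_real pi * \<i> * of_nat (case x of (q, a) \<Rightarrow> a * (N div q)) * of_nat n / of_nat N)
        = (case x of (q, a) \<Rightarrow> exp (2 * of_real pi * \<i> * of_nat a * of_nat n / of_nat q))"
      using qr by (simp add: x N mult_ac)
  next
    fix k assume k: "k \<in> {1..N}"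
    then have "gcd k N > 0"
      by simp
    then show "(case (N div gcd k N, k div gcd k N) of (q, a) \<Rightarrow> a * (N div q)) = k"
      using assms by (auto simp: div_div_eq_right)
    have "1 \<le> k div gcd k N" "k div gcd k N \<le> N div gcd k N"
      using k by (auto simp: div_le_mono div_greater_zero_iff Suc_le_eq intro!: gcd_le1_nat)
    moreover have "coprime (k div gcd k N) (N div gcd k N)"
      using k by (intro div_gcd_coprime) auto
    moreover have "N div gcd k N dvd N"
      by (metis dvd_div_mult_self dvd_triv_left gcd_dvd2)
    ultimately show "(N div gcd k N, k div gcd k N) \<in> Sigma {q. q dvd N} ?A"
      by auto
  qed
  also have "\<dots> = (if N dvd n then of_nat N else 0)"
    by (rule sum_exp_equidistant[OF assms])
  finally show ?thesis .
qed

text \<open>Moebius inversion of the divisor sum just computed. Only common divisors of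
  \<open>q\<close> and \<open>n\<close> contribute, which yields bounds uniform in
  \<open>q\<close>.\<close>

lemma ramanujan_sum_eq_moebius_sum:
  assumes "q > 0"
  shows "ramanujan_sum q n
       = (\<Sum>d | d dvd q. of_int (moebius (q div d)) * (if d dvd n then of_nat d else 0))"
  using assms
  by (intro moebius_inversion sum_ramanujan_sum_divisors[symmetric]) (auto intro: Nat.gr0I)

text \<open>After the triangle inequality and the substitution \<open>q = d * k\<close>, each common
  divisor \<open>d\<close> of \<open>N\<close> and \<open>n\<close> carries the factor
  \<open>2 ^ prime_omega (N div d)\<close>, at most \<open>2 ^ prime_omega N\<close>. What remains
  is bounded by the divisor sum of \<open>n\<close>, independently of \<open>N\<close>.\<close>

lemma sum_norm_ramanujan_sum_divisors_le:
  assumes "N > 0" "n > 0"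
  shows "(\<Sum>q | q dvd N. norm (ramanujan_sum q n)) \<le> 2 ^ prime_omega N * real (\<Sum>d | d dvd n. d)"
proof -
  let ?w = "\<lambda>d. if d dvd n then real d else 0"
  have pos: "d > 0" if "d dvd N" for d
    using that assms by (auto intro: Nat.gr0I)
  have "(\<Sum>q | q dvd N. norm (ramanujan_sum q n))
      \<le> (\<Sum>q | q dvd N. \<Sum>d | d dvd q. \<bar>real_of_int (moebius (q div d))\<bar> * ?w d)"
  proof (intro sum_mono)
    fix q assume "q \<in> {q. q dvd N}"
    then show "norm (ramanujan_sum q n) \<le> (\<Sum>d | d dvd q. \<bar>real_of_int (moebius (q div d))\<bar> * ?w d)"
      by (subst ramanujan_sum_eq_moebius_sum)
        (auto simp: pos norm_mult intro!: order.trans[OF norm_sum] sum_mono)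
  qed
  also have "\<dots> = (\<Sum>d | d dvd N. \<Sum>k | k dvd N div d. \<bar>real_of_int (moebius (d * k div d))\<bar> * ?w d)"
    by (rule sum_divisors_of_divisors[OF assms(1)])
  also have "\<dots> \<le> (\<Sum>d | d dvd N. 2 ^ prime_omega N * ?w d)"
  proof (intro sum_mono)
    fix d assume "d \<in> {d. d dvd N}"
    then obtain k where k: "N = d * k"
      by auto
    with assms have dk: "d > 0" "k > 0"
      by auto
    have "(\<Sum>j | j dvd k. \<bar>real_of_int (moebius j)\<bar>) = real_of_int (\<Sum>j | j dvd k. \<bar>moebius j\<bar>)"
      by simp
    also have "\<dots> = 2 ^ prime_omega k"
      using dk by (simp only: sum_abs_moebius_divisors) simp
    also have "\<dots> \<le> 2 ^ prime_omega N"
      unfolding prime_omega_def using assms k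
      by (intro power_increasing card_mono) (auto simp: dvd_prime_factors)
    finally show "(\<Sum>j | j dvd N div d. \<bar>real_of_int (moebius (d * j div d))\<bar> * ?w d)
        \<le> 2 ^ prime_omega N * ?w d"
      using dk by (simp add: k mult_right_mono flip: sum_distrib_right)
  qed
  also have "\<dots> = 2 ^ prime_omega N * (\<Sum>d | d dvd N. ?w d)"
    by (simp add: sum_distrib_left)
  also have "(\<Sum>d | d dvd N. ?w d) = (\<Sum>d | d dvd N \<and> d dvd n. real d)"
    using assms by (intro sum.mono_neutral_cong_right) auto
  also have "\<dots> \<le> (\<Sum>d | d dvd n. real d)"
    using assms by (intro sum_mono2) auto
  finally show ?thesis
    by (simp add: mult_left_mono)
qed

section \<open>The two-variable convolution and existence of the coefficients\<close>

lemma sum_dirichlet_conv2_moebius2: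
  assumes "n1 > 0" "n2 > 0"
  shows "(\<Sum>d1 | d1 dvd n1. \<Sum>d2 | d2 dvd n2. dirichlet_conv2 f moebius2 d1 d2) = f n1 n2"
proof -
  \<comment> \<open>Since \<open>moebius2\<close> is a product, inversion proceeds one variable at a
    time: summing over \<open>d2\<close> recovers \<open>f m1 n2\<close> and leaves a one-variable
    convolution in \<open>d1\<close>.\<close>
  have "(\<Sum>d2 | d2 dvd n2. dirichlet_conv2 f moebius2 d1 d2)
      = (\<Sum>m1 | m1 dvd d1. of_int (moebius (d1 div m1)) * f m1 n2)" for d1
  proof -
    have "(\<Sum>d2 | d2 dvd n2. dirichlet_conv2 f moebius2 d1 d2)
        = (\<Sum>m1 | m1 dvd d1. \<Sum>d2 | d2 dvd n2. of_int (moebius (d1 div m1)) *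
            (\<Sum>m2 | m2 dvd d2. of_int (moebius (d2 div m2)) * f m1 m2))"
      unfolding dirichlet_conv2_def moebius2_def
      by (subst sum.swap) (simp add: sum_distrib_left mult_ac)
    then show ?thesis
      by (simp only: sum_distrib_left[symmetric] sum_moebius_convolution[OF assms(2)])
  qed
  then show ?thesis
    by (simp add: sum_moebius_convolution[OF assms(1)])
qed

text \<open>The coefficient series is the subfamily of the full series at multiples of
  \<open>q1\<close> and \<open>q2\<close>, reached by the injection \<open>?h\<close>. Absolute
  summability passes to subfamilies.\<close>

lemma rf_coeff_term_summable:
  assumes "(\<lambda>x. norm (case x of (n1, n2) \<Rightarrow>
        dirichlet_conv2 f moebius2 n1 n2 / (of_nat n1 * of_nat n2))) summable_on ({1..} \<times> {1..})"
    and "q1 \<ge> 1" "q2 \<ge> 1"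
  shows "rf_coeff_term f q1 q2 summable_on ({1..} \<times> {1..})"
proof -
  let ?h = "\<lambda>(m1, m2). (m1 * q1, m2 * q2)"
  let ?G = "\<lambda>(n1, n2). dirichlet_conv2 f moebius2 n1 n2 / (of_nat n1 * of_nat n2)"
  have inj: "inj_on ?h ({1..} \<times> {1..})"
    using assms by (auto simp: inj_on_def)
  have "?G summable_on ?h ` ({1..} \<times> {1..})"
    using assms by (intro summable_on_subset_banach[OF abs_summable_summable[OF assms(1)]])
      (auto simp: Suc_le_eq)
  then have "(?G \<circ> ?h) summable_on ({1..} \<times> {1..})"
    by (simp only: summable_on_reindex[OF inj])
  also have "?G \<circ> ?h = rf_coeff_term f q1 q2"
    by (auto simp: rf_coeff_term_def fun_eq_iff mult_ac)
  finally show ?thesis .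
qed

section \<open>Rearrangement of the absolutely convergent series\<close>

theorem theorem2p1:
  fixes f :: "nat \<Rightarrow> nat \<Rightarrow> complex"
  assumes "(\<lambda>(n1, n2). 2 ^ prime_omega n1 * 2 ^ prime_omega n2
              * (cmod (dirichlet_conv2 f moebius2 n1 n2) / (real n1 * real n2)))
            summable_on ({1..} \<times> {1..})"
  shows "(\<forall>q1\<ge>1. \<forall>q2\<ge>1. rf_coeff_term f q1 q2 summable_on ({1..} \<times> {1..})) \<and>
         (\<forall>n1\<ge>1. \<forall>n2\<ge>1.
            ((\<lambda>(q1, q2). rf_coeff f q1 q2 * ramanujan_sum q1 n1 * ramanujan_sum q2 n2)
               has_sum f n1 n2) ({1..} \<times> {1..}))"
proof -
  let ?P = "{1..} \<times> {1..} :: (nat \<times> nat) set"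
  let ?F = "dirichlet_conv2 f moebius2"
  let ?W = "\<lambda>(N1, N2). 2 ^ prime_omega N1 * 2 ^ prime_omega N2
      * (cmod (?F N1 N2) / (real N1 * real N2))"
  \<comment> \<open>The weights are at least 1, so the hypothesis dominates the unweighted
    series.\<close>
  have "(\<lambda>x. norm (case x of (N1, N2) \<Rightarrow> ?F N1 N2 / (of_nat N1 * of_nat N2))) summable_on ?P"
  proof (rule summable_on_comparison_test[OF assms])
    fix x assume "x \<in> ?P"
    obtain N1 N2 where x: "x = (N1, N2)"
      by (cases x)
    have "1 * (cmod (?F N1 N2) / (real N1 * real N2))
        \<le> (2 ^ prime_omega N1 * 2 ^ prime_omega N2) * (cmod (?F N1 N2) / (real N1 * real N2))"
    proof (rule mult_right_mono)
      show "(1 :: real) \<le> 2 ^ prime_omega N1 * 2 ^ prime_omega N2"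
        using mult_mono[of 1 "2 ^ prime_omega N1" 1 "2 ^ prime_omega N2 :: real"] by simp
    qed simp
    then show "norm (case x of (N1, N2) \<Rightarrow> ?F N1 N2 / (of_nat N1 * of_nat N2)) \<le> ?W x"
      by (simp add: x norm_divide norm_mult)
  qed simp
  then have coeff: "rf_coeff_term f q1 q2 summable_on ?P" if "q1 \<ge> 1" "q2 \<ge> 1" for q1 q2
    using rf_coeff_term_summable that by blast

  have "((\<lambda>(q1, q2). rf_coeff f q1 q2 * ramanujan_sum q1 n1 * ramanujan_sum q2 n2)
      has_sum f n1 n2) ?P" if n: "n1 \<ge> 1" "n2 \<ge> 1" for n1 n2
  proof -
    define c1 where "c1 = (\<lambda>q. ramanujan_sum q n1)"
    define c2 where "c2 = (\<lambda>q. ramanujan_sum q n2)"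
    define K where "K = real (\<Sum>d | d dvd n1. d) * real (\<Sum>d | d dvd n2. d)"
    let ?D = "\<lambda>(N1, N2). {q :: nat. q dvd N1} \<times> {q :: nat. q dvd N2}"
    let ?t = "\<lambda>((N1, N2), (q1, q2)). ?F N1 N2 / (of_nat N1 * of_nat N2) * (c1 q1 * c2 q2)"
    let ?C = "\<lambda>(N1, N2). cmod (?F N1 N2) / (real N1 * real N2)
        * ((\<Sum>q | q dvd N1. norm (c1 q)) * (\<Sum>q | q dvd N2. norm (c2 q)))"
    \<comment> \<open>Each fibre \<open>?D x\<close> is finite, and its sum of norms
      \<open>?C x\<close> is at most \<open>K * ?W x\<close>, where \<open>K\<close> collects the
      divisor sums of \<open>n1\<close> and \<open>n2\<close> from the bound on Ramanujan
      sums.\<close>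
    have summable: "(\<lambda>z. norm (?t z)) summable_on Sigma ?P ?D"
    proof (rule summable_on_SigmaI)
      fix x assume "x \<in> ?P"
      then obtain N1 N2 where x: "x = (N1, N2)" "N1 \<ge> 1" "N2 \<ge> 1"
        by auto
      show "((\<lambda>y. norm (?t (x, y))) has_sum ?C x) (?D x)"
      proof (rule has_sum_finiteI)
        show "finite (?D x)"
          using x by auto
        show "?C x = (\<Sum>y\<in>?D x. norm (?t (x, y)))"
          unfolding x(1) prod.case sum_product sum.cartesian_product
          by (subst sum_distrib_left) (auto simp: norm_mult norm_divide intro!: sum.cong)
      qed
    next
      have "(\<lambda>x. K * ?W x) summable_on ?P"
        by (rule summable_on_cmult_right[OF assms])
      then show "?C summable_on ?P"
      proof (rule summable_on_comparison_test)
        fix x assume "x \<in> ?P"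
        then obtain N1 N2 where x: "x = (N1, N2)" "N1 \<ge> 1" "N2 \<ge> 1"
          by auto
        have "(\<Sum>q | q dvd N1. norm (c1 q)) * (\<Sum>q | q dvd N2. norm (c2 q))
            \<le> (2 ^ prime_omega N1 * real (\<Sum>d | d dvd n1. d))
              * (2 ^ prime_omega N2 * real (\<Sum>d | d dvd n2. d))"
          unfolding c1_def c2_def using x n
          by (intro mult_mono sum_norm_ramanujan_sum_divisors_le) (auto intro!: mult_nonneg_nonneg sum_nonneg)
        then have "?C x \<le> cmod (?F N1 N2) / (real N1 * real N2)
            * ((2 ^ prime_omega N1 * real (\<Sum>d | d dvd n1. d))
              * (2 ^ prime_omega N2 * real (\<Sum>d | d dvd n2. d)))"
          unfolding x(1) prod.case by (rule mult_left_mono) simp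
        also have "\<dots> = K * ?W x"
          by (simp add: x(1) K_def)
        finally show "?C x \<le> K * ?W x" .
        show "0 \<le> ?C x"
          by (auto simp: x(1) intro!: mult_nonneg_nonneg sum_nonneg divide_nonneg_nonneg)
      qed
    qed simp

    \<comment> \<open>\<open>?s\<close> is the sum over a fibre: the Ramanujan sums add up to
      \<open>N1\<close> and \<open>N2\<close>, cancelling the denominators, or one of the two sums
      is 0.\<close>
    let ?s = "\<lambda>(N1, N2). if N1 dvd n1 \<and> N2 dvd n2 then ?F N1 N2 else 0"
    have "(?t has_sum f n1 n2) (Sigma ?P ?D)"
    proof (rule has_sum_SigmaI)
      fix x assume "x \<in> ?P"
      then obtain N1 N2 where x: "x = (N1, N2)" "N1 \<ge> 1" "N2 \<ge> 1"
        by auto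
      show "((\<lambda>y. ?t (x, y)) has_sum ?s x) (?D x)"
      proof (rule has_sum_finiteI)
        show "finite (?D x)"
          using x by auto
        have "(\<Sum>y\<in>?D x. ?t (x, y)) = ?F N1 N2 / (of_nat N1 * of_nat N2)
            * ((\<Sum>q | q dvd N1. c1 q) * (\<Sum>q | q dvd N2. c2 q))"
          unfolding x(1) prod.case sum_product sum.cartesian_product
          by (subst sum_distrib_left) (auto intro!: sum.cong)
        then show "?s x = (\<Sum>y\<in>?D x. ?t (x, y))"
          using x by (simp add: c1_def c2_def sum_ramanujan_sum_divisors)
      qed
    next
      show "(?s has_sum f n1 n2) ?P"
      proof (rule has_sum_finite_neutralI[where B = "?D (n1, n2)"])
        show "finite (?D (n1, n2))"
          using n by auto
        show "?D (n1, n2) \<subseteq> ?P"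
          using n by (auto simp: Suc_le_eq intro: Nat.gr0I)
        have "(\<Sum>x\<in>?D (n1, n2). ?s x) = (\<Sum>(N1, N2)\<in>?D (n1, n2). ?F N1 N2)"
          by (intro sum.cong) auto
        then show "f n1 n2 = (\<Sum>x\<in>?D (n1, n2). ?s x)"
          using sum_dirichlet_conv2_moebius2[of n1 n2 f] n by (simp add: sum.cartesian_product)
      qed (auto split: if_splits)
    next
      show "?t summable_on Sigma ?P ?D"
        by (rule abs_summable_summable[OF summable])
    qed
    \<comment> \<open>Writing \<open>N1 = m1 * q1\<close> and \<open>N2 = m2 * q2\<close> turns the
      divisibility-constrained index set into a full product, so that \<open>q\<close> can become
      the outer index.\<close>
    also have "(?t has_sum f n1 n2) (Sigma ?P ?D) \<longleftrightarrow>
      ((\<lambda>((q1, q2), m). rf_coeff_term f q1 q2 m * (c1 q1 * c2 q2)) has_sum f n1 n2) (?P \<times> ?P)"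
      by (rule has_sum_reindex_bij_witness[where j = "\<lambda>((N1, N2), (q1, q2)). ((q1, q2), (N1 div q1, N2 div q2))"
            and i = "\<lambda>((q1, q2), (m1, m2)). ((m1 * q1, m2 * q2), (q1, q2))"])
        (auto simp: rf_coeff_term_def Suc_le_eq mult_ac elim!: dvdE)
    finally have "((\<lambda>(q1, q2). rf_coeff f q1 q2 * (c1 q1 * c2 q2)) has_sum f n1 n2) ?P"
    proof (rule has_sum_SigmaD)
      fix q assume "q \<in> ?P"
      then obtain q1 q2 where q: "q = (q1, q2)" "q1 \<ge> 1" "q2 \<ge> 1"
        by auto
      then show "((\<lambda>m. (\<lambda>((q1, q2), m). rf_coeff_term f q1 q2 m * (c1 q1 * c2 q2)) (q, m))
          has_sum (case q of (q1, q2) \<Rightarrow> rf_coeff f q1 q2 * (c1 q1 * c2 q2))) ?P"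
        \<comment> \<open>By \<open>coeff\<close>, the \<open>infsum\<close> in
          \<open>rf_coeff\<close> is a genuine sum and not the default value 0.\<close>
        using has_sum_cmult_left[OF has_sum_infsum[OF coeff]] by (simp add: rf_coeff_def)
    qed
    then show ?thesis
      by (simp add: c1_def c2_def mult.assoc)
  qed
  with coeff show ?thesis
    by blast
qed

end
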